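(* Let $T:X\to X$ be a Lipschitz map on a compact metric space $(X,d)$ with bounded local complexity, preserving a probability measure $\mu$ with a well-defined correlation dimension $D_2(\mu)$. Assume that $T$ mixes stretched exponentially. Then, for $\mu^{\otimes2}$-almost all $(x,y)$, $$\frac{-\log\min_{0\le i,j<n}d(T^ix,T^jy)}{\log n}\xrightarrow[n\to\infty]{}\frac{2}{D_2(\mu)}.$$
   Context: Bounded local complexity: a compact metric space $X$ has bounded local complexity if there is a constant $C_0$ such that, for every small enough $r>0$, there are $k(r)<\infty$ and points $x^{(r)}_1,\dots,x^{(r)}_{k(r)}\in X$ such that the balls $B(x^{(r)}_p,r)$, $1\le p\le k(r)$, cover $X$ and any point of $X$ belongs to at most $C_0$ of the balls $B(x^{(r)}_p,4r)$. Correlation dimension: $D_2(\mu)=\lim_{r\to0}\frac{\log\int\mu(B(x,r))\,d\mu(x)}{\log r}$; it is well defined if this limit exists. Lipschitz norm: $\|f\|_{\mathrm{Lip}}=\|f\|_\infty+\mathrm{Lip}(f)$, where $\mathrm{Lip}(f)$ is the best Lipschitz constant of $f$. $T$ mixes stretched exponentially: there are $c_3,C_3>0$ such that for all Lipschitz $f,g:X\to\mathbb{R}$ and all $n\in\mathbb{N}$, $$\left|\int f\cdot g\circ T^n\,d\mu-\left(\int f\,d\mu\right)\left(\int g\,d\mu\right)\right|\le C_3e^{-n^{c_3}}\|f\|_{\mathrm{Lip}}\|g\|_{\mathrm{Lip}}.$$ Conventions: $-\log0=+\infty$ and $2/0=+\infty$. *)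

theory Defs
  imports "HOL-Probability.Probability"
begin

definition is_lipschitz :: "('a::metric_space \<Rightarrow> 'b::metric_space) \<Rightarrow> bool" where
  "is_lipschitz f \<longleftrightarrow> (\<exists>L. L-lipschitz_on UNIV f)"

text \<open>
  Best Lipschitz constant and Lipschitz norm. On a compact space the supremum and the infimum
  below range over bounded nonempty sets whenever \<open>f\<close> is Lipschitz; the values are
  meaningless otherwise.
\<close>

definition best_lipschitz :: "('a::metric_space \<Rightarrow> real) \<Rightarrow> real" where
  "best_lipschitz f = Inf {L. L-lipschitz_on UNIV f}"

definition lipschitz_norm :: "('a::metric_space \<Rightarrow> real) \<Rightarrow> real" where
  "lipschitz_norm f = (SUP x. \<bar>f x\<bar>) + best_lipschitz f"

text \<open>
  The multiplicity bound counts indices, so a ball listed twice counts twice.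
\<close>

definition bounded_local_complexity :: "'a::metric_space itself \<Rightarrow> bool" where
  "bounded_local_complexity _ \<longleftrightarrow>
     (\<exists>C\<^sub>0::nat. \<forall>\<^sub>F r in at_right (0::real). \<exists>(k::nat) (c :: nat \<Rightarrow> 'a).
        (\<Union>p\<in>{1..k}. ball (c p) r) = UNIV \<and>
        (\<forall>x. card {p \<in> {1..k}. x \<in> ball (c p) (4 * r)} \<le> C\<^sub>0))"

text \<open>
  The limit defining the correlation dimension is taken in the extended reals, so that a value
  \<open>\<infinity>\<close> is not excluded by fiat.
\<close>

definition correlation_ratio :: "'a::metric_space measure \<Rightarrow> real \<Rightarrow> real" where
  "correlation_ratio \<mu> r = ln (\<integral>x. measure \<mu> (ball x r) \<partial>\<mu>) / ln r"

definition correlation_dimension_well_defined :: "'a::metric_space measure \<Rightarrow> bool" where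
  "correlation_dimension_well_defined \<mu> \<longleftrightarrow>
     (\<exists>D::ereal. ((\<lambda>r. ereal (correlation_ratio \<mu> r)) \<longlongrightarrow> D) (at_right 0))"

definition correlation_dimension :: "'a::metric_space measure \<Rightarrow> ereal" where
  "correlation_dimension \<mu> = Lim (at_right 0) (\<lambda>r. ereal (correlation_ratio \<mu> r))"

definition mixes_stretched_exponentially ::
  "'a::metric_space measure \<Rightarrow> ('a \<Rightarrow> 'a) \<Rightarrow> bool" where
  "mixes_stretched_exponentially \<mu> T \<longleftrightarrow>
     (\<exists>c C :: real. 0 < c \<and> 0 < C \<and>
        (\<forall>(f :: 'a \<Rightarrow> real) (g :: 'a \<Rightarrow> real) (n::nat).
           is_lipschitz f \<longrightarrow> is_lipschitz g \<longrightarrow>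
           \<bar>(\<integral>x. f x * g ((T ^^ n) x) \<partial>\<mu>) - (\<integral>x. f x \<partial>\<mu>) * (\<integral>x. g x \<partial>\<mu>)\<bar>
             \<le> C * exp (- (real n powr c)) * lipschitz_norm f * lipschitz_norm g))"

text \<open>
  \<open>- log t\<close> for \<open>t \<ge> 0\<close>, with the convention \<open>- log 0 = \<infinity>\<close> (whereas \<open>ln 0 = 0\<close> in HOL).
\<close>

definition neg_log :: "real \<Rightarrow> ereal" where
  "neg_log t = (if t = 0 then \<infinity> else ereal (- ln t))"

text \<open>
  Minimal distance between the orbits of \<open>x\<close> and \<open>y\<close> up to time \<open>n\<close>; unspecified for \<open>n = 0\<close>.
\<close>

definition orbit_min_dist :: "('a::metric_space \<Rightarrow> 'a) \<Rightarrow> nat \<Rightarrow> 'a \<Rightarrow> 'a \<Rightarrow> real" where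
  "orbit_min_dist T n x y = Min {dist ((T ^^ i) x) ((T ^^ j) y) | i j. i < n \<and> j < n}"

end

theory Submission
  imports Defs "HOL-Real_Asymp.Real_Asymp"
begin

text \<open>
  Write \<open>corr r\<close> for the correlation integral, the probability that two independent points are less than
  \<open>r\<close> apart. Up to time \<open>n\<close> there are \<open>n\<^sup>2\<close> pairs of times \<open>(i, j)\<close>, and by invariance each is close,
  \<open>dist (T\<^sup>i x) (T\<^sup>j y) < r\<close>, with probability \<open>corr r \<approx> r\<^sup>D\<close>. The expected number of close pairs is thus
  about \<open>n\<^sup>2 r\<^sup>D\<close>, and the critical radius is \<open>n\<^bsup>-2/D\<^esup>\<close>.
  
  For smaller radii the first moment tends to 0 polynomially (\<open>prob_orbits_close_le\<close>, \<open>AE_limsup_le\<close>).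
  For larger radii the second moment method shows that close pairs exist (\<open>prob_orbits_apart_le\<close>,
  \<open>AE_liminf_ge\<close>). In both cases the probabilities decay like a power of \<open>n\<close>; the Borel-Cantelli lemma
  along \<open>n = 2\<^sup>k\<close> and the monotonicity of the minimal distance in \<open>n\<close> give the almost sure statement.
  
  The second moment is a sum over two pairs \<open>(i, j)\<close> and \<open>(i', j')\<close> (\<open>UU_le\<close>). If \<open>\<bar>i - i'\<bar>\<close> and \<open>\<bar>j - j'\<bar>\<close>
  both exceed a gap \<open>L = n\<^sup>\<delta>\<close>, stretched exponential mixing makes the two events nearly independent: one
  freezes \<open>y\<close> and uses mixing in \<open>x\<close>, which leaves the correlations of \<open>F y = \<integral> h y x d\<mu>(x)\<close>, where \<open>h\<close> is
  a Lipschitz version of the indicator of closeness; then one uses mixing in \<open>y\<close>. The Lipschitz norms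
  involved are of order \<open>1 / r\<close>, a power of \<open>n\<close>, which the mixing rate absorbs. If only one of the gaps
  is large, the correlation is at most \<open>\<integral> F\<^sup>2 d\<mu>\<close>. There are about \<open>n\<^sup>3 L\<close> such terms, so they are
  negligible against the squared mean \<open>n\<^sup>4 (corr r)\<^sup>2\<close> as soon as \<open>\<integral> F\<^sup>2 d\<mu>\<close> is of order
  \<open>(corr r)\<^bsup>3/2\<^esup>\<close>. This holds because a ball of radius \<open>r\<close> has measure at most \<open>(corr (2 r))\<^bsup>1/2\<^esup>\<close>
  (\<open>measure_ball_power2_le\<close>): any two of its points are within \<open>2 r\<close> of each other. If neither gap is
  large, there are about \<open>n\<^sup>2 L\<^sup>2\<close> terms, each at most the probability of a single close pair.
\<close>

section \<open>The minimal distance between two orbits\<close>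

lemma orbit_min_dist_less_iff:
  assumes "0 < n"
  shows "orbit_min_dist S n x y < r \<longleftrightarrow> (\<exists>i<n. \<exists>j<n. dist ((S ^^ i) x) ((S ^^ j) y) < r)"
proof -
  have "finite {dist ((S ^^ i) x) ((S ^^ j) y) | i j. i < n \<and> j < n}"
    using finite_image_set2[of "\<lambda>i. i < n" "\<lambda>j. j < n"] by simp
  moreover have "{dist ((S ^^ i) x) ((S ^^ j) y) | i j. i < n \<and> j < n} \<noteq> {}"
    using assms by blast
  ultimately show ?thesis
    unfolding orbit_min_dist_def by (subst Min_less_iff) auto
qed

lemma orbit_min_dist_nonneg: "0 < n \<Longrightarrow> 0 \<le> orbit_min_dist S n x y"
  using orbit_min_dist_less_iff[of n S x y 0] by (auto simp flip: not_less)

lemma orbit_min_dist_antimono: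
  assumes "0 < m" "m \<le> n"
  shows "orbit_min_dist S n x y \<le> orbit_min_dist S m x y"
proof (rule ccontr)
  assume "\<not> ?thesis"
  then have "orbit_min_dist S m x y < orbit_min_dist S n x y" by simp
  then obtain i j where "i < m" "j < m" "dist ((S ^^ i) x) ((S ^^ j) y) < orbit_min_dist S n x y"
    using assms by (subst (asm) orbit_min_dist_less_iff) auto
  then have "orbit_min_dist S n x y < orbit_min_dist S n x y"
    using assms by (subst orbit_min_dist_less_iff) (auto intro: less_le_trans)
  then show False by simp
qed

lemma neg_log_ratio_le:
  assumes "2 \<le> n" "real n powr (- t) \<le> u"
  shows "neg_log u / ereal (ln (real n)) \<le> ereal t"
proof -
  have ln: "0 < ln (real n)" using assms by simp
  have u: "0 < u" using assms by (intro less_le_trans[OF _ assms(2)]) simp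
  have "- t * ln (real n) = ln (real n powr (- t))" using assms by (simp add: ln_powr)
  also have "\<dots> \<le> ln u" using assms u by (subst ln_le_cancel_iff) auto
  finally show ?thesis using u ln by (simp add: neg_log_def field_simps)
qed

lemma neg_log_ratio_ge:
  assumes "2 \<le> n" "0 \<le> u" "u \<le> real n powr (- s)"
  shows "ereal s \<le> neg_log u / ereal (ln (real n))"
proof (cases "u = 0")
  case False
  have ln: "0 < ln (real n)" using assms by simp
  have "ln u \<le> ln (real n powr (- s))" using assms False by (subst ln_le_cancel_iff) auto
  also have "\<dots> = - s * ln (real n)" using assms by (simp add: ln_powr)
  finally show ?thesis using False ln by (simp add: neg_log_def field_simps)
qed (use assms in \<open>simp add: neg_log_def\<close>)

section \<open>Measure preserving systems on compact metric spaces\<close>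

locale compact_mp_system = prob_space \<mu>
  for \<mu> :: "'a::metric_space measure" and T :: "'a \<Rightarrow> 'a" +
  assumes compact_space: "compact (UNIV :: 'a set)"
    and sets_borel [measurable_cong]: "sets \<mu> = sets borel"
    and T_measurable [measurable]: "T \<in> measurable \<mu> \<mu>"
    and T_invariant: "distr \<mu> \<mu> T = \<mu>"
begin

sublocale P: pair_prob_space \<mu> \<mu> ..

abbreviation \<mu>\<mu> :: "('a \<times> 'a) measure" where
  "\<mu>\<mu> \<equiv> \<mu> \<Otimes>\<^sub>M \<mu>"

abbreviation corr :: "real \<Rightarrow> real" where
  "corr r \<equiv> (\<integral>x. measure \<mu> (ball x r) \<partial>\<mu>)"

lemma space_eq [simp]: "space \<mu> = UNIV"
  using sets_eq_imp_space_eq[OF sets_borel] by simp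

lemma space_pair_eq [simp]: "space \<mu>\<mu> = UNIV"
  by (simp add: space_pair_measure)

lemma prob_UNIV [simp]: "prob UNIV = 1"
  using prob_space by simp

lemma ball_sets [measurable]: "ball x r \<in> sets \<mu>"
  by (simp add: sets_borel)

lemma continuous_measurable: 
  fixes f :: "'a \<Rightarrow> real"
  assumes "continuous_on UNIV f"
  shows "f \<in> borel_measurable \<mu>"
  using borel_measurable_continuous_onI[OF assms] sets_borel measurable_cong_sets by blast

lemma lipschitz_measurable: 
  fixes f :: "'a \<Rightarrow> real"
  assumes "K-lipschitz_on UNIV f"
  shows "f \<in> borel_measurable \<mu>"
  by (intro continuous_measurable lipschitz_on_continuous_on[OF assms])

text \<open>
  The product sigma-algebra is generated by rectangles and need not contain the open sets of the
  product unless the space is second countable. Compactness provides a countable dense set \<open>E\<close>,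
  and \<open>dist x y < a\<close> holds iff \<open>dist c x + dist c y < a\<close> for some \<open>c \<in> E\<close>, which is a countable
  union of measurable conditions.
\<close>

lemma dist_measurable: "(\<lambda>p. dist (fst p) (snd p)) \<in> borel_measurable \<mu>\<mu>"
proof -
  have "\<exists>k. finite k \<and> UNIV \<subseteq> (\<Union>x\<in>k. ball (x::'a) (inverse (Suc n)))" for n
    using compact_space unfolding compact_eq_totally_bounded by simp
  then obtain D where D: "\<And>n. finite (D n)" "\<And>n. UNIV \<subseteq> (\<Union>x\<in>D n. ball (x::'a) (inverse (Suc n)))"
    by metis
  define E where "E = (\<Union>n. D n)"
  have E: "countable E" unfolding E_def using D(1) by (intro countable_UN) (auto intro: countable_finite)
  have eq: "{p \<in> space \<mu>\<mu>. dist (fst p) (snd p) < a} =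
     (\<Union>c\<in>E. {p \<in> space \<mu>\<mu>. dist c (fst p) + dist c (snd p) < a})" for a
  proof (intro equalityI subsetI)
    fix p assume p: "p \<in> {p \<in> space \<mu>\<mu>. dist (fst p) (snd p) < a}"
    obtain x y where xy: "p = (x, y)" by force
    have "(a - dist x y) / 2 > 0" using p xy by simp
    then obtain n where n: "inverse (real (Suc n)) < (a - dist x y) / 2"
      using reals_Archimedean by blast
    have "x \<in> (\<Union>c\<in>D n. ball c (inverse (Suc n)))" using D(2) by (rule subsetD) simp
    then obtain c where c: "c \<in> D n" "dist c x < inverse (Suc n)" unfolding UN_iff mem_ball by (elim bexE)
    have "dist c y \<le> dist c x + dist x y" by (rule dist_triangle)
    then have "dist c x + dist c y < a" using c n by simp
    then show "p \<in> (\<Union>c\<in>E. {p \<in> space \<mu>\<mu>. dist c (fst p) + dist c (snd p) < a})"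
      using c xy unfolding E_def by auto
  next
    fix p assume "p \<in> (\<Union>c\<in>E. {p \<in> space \<mu>\<mu>. dist c (fst p) + dist c (snd p) < a})"
    then obtain c where "dist c (fst p) + dist c (snd p) < a" by auto
    then have "dist (fst p) (snd p) < a"
      using dist_triangle3[of "fst p" "snd p" c] by linarith
    then show "p \<in> {p \<in> space \<mu>\<mu>. dist (fst p) (snd p) < a}" by simp
  qed
  have [measurable]: "(\<lambda>x. dist c x) \<in> borel_measurable \<mu>" for c :: 'a
    by (intro continuous_measurable continuous_intros)
  have "{p \<in> space \<mu>\<mu>. dist c (fst p) + dist c (snd p) < a} \<in> sets \<mu>\<mu>" for c a
    by measurable
  then show ?thesis
    unfolding borel_measurable_iff_less eq
    by (intro allI sets.countable_UN'' E)
qed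

lemma dist_measurable' [measurable (raw)]:
  assumes [measurable]: "f \<in> measurable M \<mu>" "g \<in> measurable M \<mu>"
  shows "(\<lambda>z. dist (f z) (g z)) \<in> borel_measurable M"
  using measurable_compose[OF measurable_Pair[OF assms] dist_measurable] by simp

lemma iterate_measurable [measurable]: "T ^^ n \<in> measurable \<mu> \<mu>"
  by (rule measurable_compose_n) simp

lemma iterate_invariant: "distr \<mu> \<mu> (T ^^ n) = \<mu>"
proof (induction n)
  case 0
  show ?case by (simp add: distr_id[unfolded id_def])
next
  case (Suc n)
  have "distr \<mu> \<mu> (T ^^ Suc n) = distr (distr \<mu> \<mu> (T ^^ n)) \<mu> T"
    by (simp add: distr_distr)
  then show ?case by (simp only: Suc T_invariant)
qed

lemma integral_iterate:
  fixes f :: "'a \<Rightarrow> real"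
  assumes [measurable]: "f \<in> borel_measurable \<mu>"
  shows "(\<integral>x. f ((T ^^ n) x) \<partial>\<mu>) = (\<integral>x. f x \<partial>\<mu>)"
  using integral_distr[of "T ^^ n" \<mu> \<mu> f] by (simp add: iterate_invariant)

lemma pair_iterate_invariant:
  "distr \<mu>\<mu> \<mu>\<mu> (\<lambda>(x, y). ((T ^^ i) x, (T ^^ j) y)) = \<mu>\<mu>"
  using pair_measure_distr[of "T ^^ i" \<mu> \<mu> "T ^^ j" \<mu> \<mu>]
  by (simp add: iterate_invariant sigma_finite_measure_axioms)

lemma integral_pair_iterate:
  fixes f :: "'a \<times> 'a \<Rightarrow> real"
  assumes [measurable]: "f \<in> borel_measurable \<mu>\<mu>"
  shows "(\<integral>p. f ((T ^^ i) (fst p), (T ^^ j) (snd p)) \<partial>\<mu>\<mu>) = (\<integral>p. f p \<partial>\<mu>\<mu>)"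
  using integral_distr[of "\<lambda>(x, y). ((T ^^ i) x, (T ^^ j) y)" \<mu>\<mu> \<mu>\<mu> f]
  by (simp add: pair_iterate_invariant split_beta)

lemma pair_integral:
  fixes f :: "'a \<times> 'a \<Rightarrow> real"
  assumes [measurable]: "f \<in> borel_measurable \<mu>\<mu>" and b: "\<And>p. \<bar>f p\<bar> \<le> B"
  shows "(\<integral>p. f p \<partial>\<mu>\<mu>) = (\<integral>x. (\<integral>y. f (x, y) \<partial>\<mu>) \<partial>\<mu>)"
    and "(\<integral>p. f p \<partial>\<mu>\<mu>) = (\<integral>y. (\<integral>x. f (x, y) \<partial>\<mu>) \<partial>\<mu>)"
proof -
  have "integrable \<mu>\<mu> f"
    by (rule P.P.integrable_const_bound[where B = B]) (auto simp: b)
  then show "(\<integral>p. f p \<partial>\<mu>\<mu>) = (\<integral>x. (\<integral>y. f (x, y) \<partial>\<mu>) \<partial>\<mu>)"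
    and "(\<integral>p. f p \<partial>\<mu>\<mu>) = (\<integral>y. (\<integral>x. f (x, y) \<partial>\<mu>) \<partial>\<mu>)"
    using P.integral_fst'[of f] P.integral_snd[of "\<lambda>x y. f (x, y)"] by auto
qed

lemma near_diagonal_measurable [measurable]: "{p. dist (fst p) (snd p) < r} \<in> sets \<mu>\<mu>"
  using borel_measurable_iff_less[of "\<lambda>p. dist (fst p) (snd p)" \<mu>\<mu>] dist_measurable by simp

section \<open>The correlation integral\<close>

lemma measure_near_diagonal: "measure \<mu>\<mu> {p. dist (fst p) (snd p) < r} = corr r"
proof -
  have "measure \<mu>\<mu> {p. dist (fst p) (snd p) < r}
      = (\<integral>p. indicator {p. dist (fst p) (snd p) < r} p \<partial>\<mu>\<mu>)"
    by simp
  also have "\<dots> = (\<integral>x. (\<integral>y. indicator {p. dist (fst p) (snd p) < r} (x, y) \<partial>\<mu>) \<partial>\<mu>)"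
    by (rule pair_integral(1)[where B = 1]) (auto simp: indicator_def)
  also have "\<dots> = (\<integral>x. (\<integral>y. indicator (ball x r) y \<partial>\<mu>) \<partial>\<mu>)"
    by (intro Bochner_Integration.integral_cong refl) (auto simp: indicator_def)
  finally show ?thesis by simp
qed

text \<open>
  Two points of the same ball of radius \<open>r\<close> are less than \<open>2 * r\<close> apart. This uniform bound on the
  measure of balls is what keeps the variance small in the second moment argument: it plays the
  role of the inequality \<open>max p \<le> (\<Sum> p\<^sup>2)\<^bsup>1/2\<^esup>\<close> between norms of a probability vector.
\<close>

lemma measure_ball_power2_le: "measure \<mu> (ball x r) ^ 2 \<le> corr (2 * r)"
proof -
  have "measure \<mu> (ball x r) ^ 2 = measure \<mu>\<mu> (ball x r \<times> ball x r)"
    by (simp add: measure_def emeasure_pair_measure_Times enn2real_mult power2_eq_square)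
  also have "\<dots> \<le> measure \<mu>\<mu> {p. dist (fst p) (snd p) < 2 * r}"
  proof (rule P.P.finite_measure_mono)
    have "dist y z < 2 * r" if "dist x y < r" "dist x z < r" for y z
      using that dist_triangle3[of y z x] by linarith
    then show "ball x r \<times> ball x r \<subseteq> {p. dist (fst p) (snd p) < 2 * r}"
      by auto
  qed simp
  finally show ?thesis by (simp add: measure_near_diagonal)
qed

text \<open>
  Finitely many balls of radius \<open>r / 2\<close> cover the space, so one of them has positive measure.
  Positivity matters because \<open>ln 0 = 0\<close> would make the correlation ratio meaningless.
\<close>

lemma corr_pos: "0 < r \<Longrightarrow> 0 < corr r"
proof -
  assume r: "0 < r"
  obtain k where k: "finite k" "UNIV \<subseteq> (\<Union>x\<in>k. ball (x::'a) (r / 2))"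
    using compact_space r unfolding compact_eq_totally_bounded by (meson half_gt_zero)
  have "\<exists>x. measure \<mu> (ball x (r / 2)) \<noteq> 0"
  proof (rule ccontr)
    assume "\<not> ?thesis"
    then have "measure \<mu> (\<Union>x\<in>k. ball x (r / 2)) \<le> 0"
      using finite_measure_subadditive_finite[OF k(1), of "\<lambda>x. ball x (r / 2)"] by (simp add: image_subset_iff)
    moreover have "(\<Union>x\<in>k. ball x (r / 2)) = space \<mu>" using k by auto
    ultimately show False using prob_space by simp
  qed
  then obtain x where "measure \<mu> (ball x (r / 2)) \<noteq> 0" ..
  then have "0 < measure \<mu> (ball x (r / 2)) ^ 2" by simp
  also have "\<dots> \<le> corr r" using measure_ball_power2_le[of x "r / 2"] by simp
  finally show ?thesis .
qed

lemma corr_le_1: "corr r \<le> 1"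
  by (simp flip: measure_near_diagonal)

lemma orbit_events_measurable [measurable]:
  "{p. \<exists>i<n. \<exists>j<n. dist ((T ^^ i) (fst p)) ((T ^^ j) (snd p)) < r} \<in> sets \<mu>\<mu>"
proof -
  have "{p \<in> space \<mu>\<mu>. \<exists>i\<in>{..<n}. \<exists>j\<in>{..<n}. dist ((T ^^ i) (fst p)) ((T ^^ j) (snd p)) < r} \<in> sets \<mu>\<mu>"
    by measurable
  then show ?thesis by (simp add: Bex_def)
qed

text \<open>
  First moment bound. By invariance each pair \<open>(T\<^sup>i x, T\<^sup>j y)\<close> has the same law as \<open>(x, y)\<close>, so each of
  the \<open>n\<^sup>2\<close> coincidences has probability \<open>corr r\<close>.
\<close>

lemma prob_orbits_close_le:
  "measure \<mu>\<mu> {p. \<exists>i<n. \<exists>j<n. dist ((T ^^ i) (fst p)) ((T ^^ j) (snd p)) < r} \<le> real n ^ 2 * corr r"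
proof -
  let ?E = "\<lambda>i j. {p \<in> space \<mu>\<mu>. dist ((T ^^ i) (fst p)) ((T ^^ j) (snd p)) < r}"
  have [measurable]: "?E i j \<in> sets \<mu>\<mu>" for i j by measurable
  have E: "measure \<mu>\<mu> (?E i j) = corr r" for i j
  proof -
    have "measure \<mu>\<mu> (?E i j) = measure (distr \<mu>\<mu> \<mu>\<mu> (\<lambda>(x, y). ((T ^^ i) x, (T ^^ j) y))) {p. dist (fst p) (snd p) < r}"
      by (subst measure_distr) (auto intro!: arg_cong[where f = "measure \<mu>\<mu>"])
    then show ?thesis by (simp add: pair_iterate_invariant measure_near_diagonal)
  qed
  have "{p. \<exists>i<n. \<exists>j<n. dist ((T ^^ i) (fst p)) ((T ^^ j) (snd p)) < r} = (\<Union>z\<in>{..<n}\<times>{..<n}. ?E (fst z) (snd z))"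
    by (simp add: set_eq_iff) blast
  also have "measure \<mu>\<mu> \<dots> \<le> (\<Sum>z\<in>{..<n}\<times>{..<n}. measure \<mu>\<mu> (?E (fst z) (snd z)))"
    by (rule P.P.finite_measure_subadditive_finite) (auto simp del: space_pair_eq)
  also have "\<dots> = real n ^ 2 * corr r"
    unfolding E by (simp add: power2_eq_square)
  finally show ?thesis .
qed

end

section \<open>Second moment of the number of close pairs\<close>

text \<open>
  The kernel \<open>h\<close> is a Lipschitz substitute for the indicator of \<open>dist x y < r\<close>. Decorrelation is
  required only after \<open>L\<close> steps and with a uniform error \<open>\<epsilon>\<close>, and only for functions of a single
  point: the functions that occur are \<open>h x\<close>, with one of the two points frozen, and the average \<open>F\<close>.
\<close>

locale decorrelated_kernel = compact_mp_system \<mu> T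
  for \<mu> :: "'a::metric_space measure" and T :: "'a \<Rightarrow> 'a" +
  fixes h :: "'a \<Rightarrow> 'a \<Rightarrow> real" and K \<epsilon> :: real and L :: nat
  assumes h_nonneg: "0 \<le> h x y" and h_le_1: "h x y \<le> 1"
    and h_sym: "h x y = h y x"
    and h_lipschitz: "K-lipschitz_on UNIV (h x)"
    and h_measurable: "(\<lambda>p. h (fst p) (snd p)) \<in> borel_measurable (\<mu> \<Otimes>\<^sub>M \<mu>)"
    and \<epsilon>_nonneg: "0 \<le> \<epsilon>"
    and decorrelation: "\<And>f g n. \<lbrakk>L \<le> n; K-lipschitz_on UNIV f; K-lipschitz_on UNIV g;
      \<And>x. 0 \<le> f x \<and> f x \<le> 1; \<And>x. 0 \<le> g x \<and> g x \<le> 1\<rbrakk>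
      \<Longrightarrow> (\<integral>x. f x * g ((T ^^ n) x) \<partial>\<mu>) \<le> (\<integral>x. f x \<partial>\<mu>) * (\<integral>x. g x \<partial>\<mu>) + \<epsilon>"
begin

lemma h_measurable' [measurable (raw)]:
  assumes [measurable]: "f \<in> measurable M \<mu>" "g \<in> measurable M \<mu>"
  shows "(\<lambda>z. h (f z) (g z)) \<in> borel_measurable M"
  using measurable_compose[OF measurable_Pair[OF assms] h_measurable] by simp

definition F :: "'a \<Rightarrow> real" where "F y = (\<integral>x. h y x \<partial>\<mu>)"
definition A :: real where "A = (\<integral>y. F y \<partial>\<mu>)"
definition B :: real where "B = (\<integral>y. F y ^ 2 \<partial>\<mu>)"
definition U :: "nat \<Rightarrow> nat \<Rightarrow> 'a \<times> 'a \<Rightarrow> real" where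
  "U i j p = h ((T ^^ i) (fst p)) ((T ^^ j) (snd p))"
definition S :: "nat \<Rightarrow> 'a \<times> 'a \<Rightarrow> real" where
  "S n p = (\<Sum>i<n. \<Sum>j<n. U i j p)"
definition far :: "nat \<Rightarrow> nat \<Rightarrow> bool" where
  "far i j \<longleftrightarrow> i + L \<le> j \<or> j + L \<le> i"

lemma h_abs: "\<bar>h x y\<bar> \<le> 1"
  using h_nonneg[of x y] h_le_1[of x y] by simp

lemma integrable_h: "integrable \<mu> (h y)"
  by (rule integrable_const_bound[where B = 1]) (auto simp: h_abs)

lemma F_nonneg: "0 \<le> F y" and F_le_1: "F y \<le> 1"
proof -
  show "0 \<le> F y" unfolding F_def by (simp add: h_nonneg)
  have "F y \<le> (\<integral>x. 1 \<partial>\<mu>)" unfolding F_def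
    by (intro integral_mono integrable_h) (auto simp: h_le_1)
  then show "F y \<le> 1" by (simp add: prob_space)
qed

lemma F_abs: "\<bar>F x\<bar> \<le> 1"
  using F_nonneg[of x] F_le_1[of x] by simp

text \<open>
  Averaging keeps the Lipschitz constant, so that the mixing hypothesis applies to \<open>F\<close> as well.
\<close>

lemma F_lipschitz: "K-lipschitz_on UNIV F"
proof (rule lipschitz_onI)
  show "0 \<le> K" using h_lipschitz lipschitz_on_nonneg by blast
  fix x y
  have "\<bar>h x z - h y z\<bar> \<le> K * dist x y" for z
    using lipschitz_onD[OF h_lipschitz[of z], of x y] by (simp add: h_sym[of z] dist_real_def)
  then have "\<bar>\<integral>z. h x z - h y z \<partial>\<mu>\<bar> \<le> (\<integral>z. K * dist x y \<partial>\<mu>)"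
    using integrable_h by (intro order_trans[OF integral_abs_bound] integral_mono) auto
  then show "dist (F x) (F y) \<le> K * dist x y"
    using integrable_h by (simp add: F_def dist_real_def prob_space)
qed

lemma F_measurable [measurable]: "F \<in> borel_measurable \<mu>"
  by (rule lipschitz_measurable[OF F_lipschitz])

lemma U_measurable [measurable]: "U i j \<in> borel_measurable \<mu>\<mu>"
  unfolding U_def by measurable

lemma U_nonneg: "0 \<le> U i j p" and U_le_1: "U i j p \<le> 1"
  unfolding U_def by (auto simp: h_nonneg h_le_1)

lemma UU_abs: "\<bar>U i j p * U i' j' p\<bar> \<le> 1"
  using U_nonneg U_le_1 by (simp add: abs_mult mult_le_one)

lemma integrable_UU: "integrable \<mu>\<mu> (\<lambda>p. U i j p * U i' j' p)"
  by (rule P.P.integrable_const_bound[where B = 1]) (auto simp: UU_abs)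

lemma integrable_U: "integrable \<mu>\<mu> (U i j)"
  by (rule P.P.integrable_const_bound[where B = 1]) (auto simp: U_nonneg U_le_1)

lemma integrable_FF: "integrable \<mu> (\<lambda>y. F ((T ^^ i) y) * F ((T ^^ j) y))"
  by (rule integrable_const_bound[where B = 1]) (auto simp: abs_mult intro!: mult_le_one F_abs)

lemma integrable_F2: "integrable \<mu> (\<lambda>y. F ((T ^^ i) y) ^ 2)"
  using integrable_FF[of i i] by (simp add: power2_eq_square)

lemma integral_U: "(\<integral>p. U i j p \<partial>\<mu>\<mu>) = A"
proof -
  have "(\<integral>p. U i j p \<partial>\<mu>\<mu>) = (\<integral>p. h (fst p) (snd p) \<partial>\<mu>\<mu>)"
    using integral_pair_iterate[of "\<lambda>p. h (fst p) (snd p)" i j] h_measurable by (simp add: U_def)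
  also have "\<dots> = A"
    using pair_integral(1)[of "\<lambda>p. h (fst p) (snd p)" 1] h_abs h_measurable by (simp add: A_def F_def)
  finally show ?thesis .
qed

text \<open>
  By invariance and \<open>2uv \<le> u\<^sup>2 + v\<^sup>2\<close>; this is the bound for times that are too close to decorrelate.
\<close>

lemma FF_le_B: "(\<integral>y. F ((T ^^ i) y) * F ((T ^^ j) y) \<partial>\<mu>) \<le> B"
proof -
  have "(\<integral>y. F ((T ^^ i) y) * F ((T ^^ j) y) \<partial>\<mu>)
     \<le> (\<integral>y. (F ((T ^^ i) y) ^ 2 + F ((T ^^ j) y) ^ 2) / 2 \<partial>\<mu>)"
  proof (intro integral_mono integrable_FF)
    show "F ((T ^^ i) y) * F ((T ^^ j) y) \<le> (F ((T ^^ i) y) ^ 2 + F ((T ^^ j) y) ^ 2) / 2" for y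
      using sum_squares_bound[of "F ((T ^^ i) y)" "F ((T ^^ j) y)"] by simp
  qed (auto intro!: integrable_F2)
  also have "\<dots> = ((\<integral>y. F ((T ^^ i) y) ^ 2 \<partial>\<mu>) + (\<integral>y. F ((T ^^ j) y) ^ 2 \<partial>\<mu>)) / 2"
    using integrable_F2 by simp
  also have "\<dots> = B"
    using integral_iterate[of "\<lambda>y. F y ^ 2"] by (simp add: B_def)
  finally show ?thesis .
qed

lemma FF_far:
  assumes "far i j"
  shows "(\<integral>y. F ((T ^^ i) y) * F ((T ^^ j) y) \<partial>\<mu>) \<le> A ^ 2 + \<epsilon>"
proof -
  have *: "(\<integral>y. F ((T ^^ i) y) * F ((T ^^ j) y) \<partial>\<mu>) \<le> A ^ 2 + \<epsilon>" if "i + L \<le> j" for i j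
  proof -
    have j: "j = (j - i) + i" using that by simp
    have "(\<integral>y. F ((T ^^ i) y) * F ((T ^^ j) y) \<partial>\<mu>) = (\<integral>y. F ((T ^^ i) y) * F ((T ^^ (j - i)) ((T ^^ i) y)) \<partial>\<mu>)"
      by (subst (1) j) (simp only: funpow_add o_apply)
    also have "\<dots> = (\<integral>y. F y * F ((T ^^ (j - i)) y) \<partial>\<mu>)"
      using integral_iterate[of "\<lambda>y. F y * F ((T ^^ (j - i)) y)" i] by simp
    also have "\<dots> \<le> A * A + \<epsilon>" unfolding A_def
      using that by (intro decorrelation F_lipschitz) (auto simp: F_nonneg F_le_1)
    finally show ?thesis by (simp add: power2_eq_square)
  qed
  show ?thesis
    using assms *[of i j] *[of j i] unfolding far_def by (auto simp: mult.commute)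
qed

text \<open>
  With the second point frozen, the two factors are functions of \<open>T\<^sup>i x\<close> and \<open>T\<^bsup>i'\<^esup> x\<close>, which decorrelate;
  averaging over \<open>x\<close> turns both into values of \<open>F\<close>. As the second point is frozen, \<open>j\<close> and \<open>j'\<close> may be
  in either order.
\<close>

lemma UU_far_fst:
  assumes "far i i'"
  shows "(\<integral>p. U i j p * U i' j' p \<partial>\<mu>\<mu>) \<le> (\<integral>y. F ((T ^^ j) y) * F ((T ^^ j') y) \<partial>\<mu>) + \<epsilon>"
proof -
  have *: "(\<integral>p. U i j p * U i' j' p \<partial>\<mu>\<mu>) \<le> (\<integral>y. F ((T ^^ j) y) * F ((T ^^ j') y) \<partial>\<mu>) + \<epsilon>" 
    if "i + L \<le> i'" for i i' j j'
  proof -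
    have i': "i' = (i' - i) + i" using that by simp
    let ?G = "\<lambda>p. U i j p * U i' j' p"
    have le: "(\<integral>x. ?G (x, y) \<partial>\<mu>) \<le> F ((T ^^ j) y) * F ((T ^^ j') y) + \<epsilon>" for y
    proof -
      have "(\<integral>x. ?G (x, y) \<partial>\<mu>) =
         (\<integral>x. h ((T ^^ j) y) ((T ^^ i) x) * h ((T ^^ j') y) ((T ^^ (i' - i)) ((T ^^ i) x)) \<partial>\<mu>)"
        unfolding U_def by (subst (1) i') (simp only: funpow_add o_apply fst_conv snd_conv h_sym)
      also have "\<dots> = (\<integral>x. h ((T ^^ j) y) x * h ((T ^^ j') y) ((T ^^ (i' - i)) x) \<partial>\<mu>)"
        using integral_iterate[of "\<lambda>x. h ((T ^^ j) y) x * h ((T ^^ j') y) ((T ^^ (i' - i)) x)" i] by simp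
      also have "\<dots> \<le> F ((T ^^ j) y) * F ((T ^^ j') y) + \<epsilon>" unfolding F_def
        using that by (intro decorrelation h_lipschitz) (auto simp: h_nonneg h_le_1)
      finally show ?thesis .
    qed
    have "(\<integral>p. ?G p \<partial>\<mu>\<mu>) = (\<integral>y. (\<integral>x. ?G (x, y) \<partial>\<mu>) \<partial>\<mu>)"
      by (rule pair_integral(2)[where B = 1]) (use UU_abs in auto)
    also have "\<dots> \<le> (\<integral>y. F ((T ^^ j) y) * F ((T ^^ j') y) + \<epsilon> \<partial>\<mu>)"
    proof (rule integral_mono)
      show "integrable \<mu> (\<lambda>y. \<integral>x. ?G (x, y) \<partial>\<mu>)"
        using P.integrable_snd[of "\<lambda>x y. ?G (x, y)"] integrable_UU by (simp add: split_beta')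
    qed (use integrable_FF le in auto)
    also have "\<dots> = (\<integral>y. F ((T ^^ j) y) * F ((T ^^ j') y) \<partial>\<mu>) + \<epsilon>"
      using integrable_FF by (simp add: prob_space)
    finally show ?thesis .
  qed
  show ?thesis
    using assms *[of i i' j j'] *[of i' i j' j] unfolding far_def by (auto simp: mult.commute)
qed

text \<open>
  The previous bound with the roles of the two points exchanged, by the symmetry of \<open>h\<close>.
\<close>

lemma UU_far_snd:
  assumes "far j j'"
  shows "(\<integral>p. U i j p * U i' j' p \<partial>\<mu>\<mu>) \<le> (\<integral>y. F ((T ^^ i) y) * F ((T ^^ i') y) \<partial>\<mu>) + \<epsilon>"
proof -
  have swap: "U i j (x, y) = U j i (y, x)" for i j x y
    by (simp add: U_def h_sym)
  have "(\<integral>p. U i j p * U i' j' p \<partial>\<mu>\<mu>) = (\<integral>(x, y). U i j (y, x) * U i' j' (y, x) \<partial>\<mu>\<mu>)"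
    using P.integral_product_swap[of "\<lambda>p. U i j p * U i' j' p"] by simp
  also have "\<dots> = (\<integral>p. U j i p * U j' i' p \<partial>\<mu>\<mu>)"
    unfolding swap[of i j] swap[of i' j'] by (simp add: split_beta')
  also have "\<dots> \<le> (\<integral>y. F ((T ^^ i) y) * F ((T ^^ i') y) \<partial>\<mu>) + \<epsilon>"
    by (rule UU_far_fst[OF assms])
  finally show ?thesis .
qed

text \<open>
  The three regimes in one inequality. If both gaps are large, the product behaves as for independent
  variables. If one gap is large, the correlation is at most that of \<open>F\<close> with itself, hence \<open>B\<close>. If none
  is large, one factor is bounded by 1. The indicators count how rarely the last two regimes occur.
\<close>

lemma UU_le:
  "(\<integral>p. U i j p * U i' j' p \<partial>\<mu>\<mu>) \<le> A ^ 2 + 2 * \<epsilon>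
     + (of_bool (\<not> far i i') + of_bool (\<not> far j j')) * B + of_bool (\<not> far i i') * of_bool (\<not> far j j') * A"
proof -
  have "(\<integral>p. U i j p * U i' j' p \<partial>\<mu>\<mu>) \<le> (\<integral>p. U i j p \<partial>\<mu>\<mu>)"
    by (intro integral_mono integrable_UU integrable_U mult_left_le U_le_1 U_nonneg)
  then have 1: "(\<integral>p. U i j p * U i' j' p \<partial>\<mu>\<mu>) \<le> A" by (simp add: integral_U)
  have 2: "0 \<le> B" unfolding B_def by simp
  obtain q where q: "A ^ 2 = q" "0 \<le> q" by simp
  show ?thesis
    using 1 2 q(2) \<epsilon>_nonneg UU_far_fst[of i i' j j'] UU_far_snd[of j j' i i'] FF_far[of j j']
      FF_le_B[of j j'] FF_le_B[of i i']
    unfolding q(1) by (cases "far i i'"; cases "far j j'") auto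
qed

lemma near_pairs_le: "(\<Sum>i<n. \<Sum>j<n. of_bool (\<not> far i j)) \<le> (2 * real L * real n)"
proof -
  have "(\<Sum>j<n. of_bool (\<not> far i j)) \<le> 2 * real L" if "i < n" for i
  proof -
    have "(\<Sum>j<n. of_bool (\<not> far i j) :: real) = real (card ({..<n} \<inter> {j. \<not> far i j}))"
      by simp
    \<comment> \<open>Truncated subtraction only shortens the second interval, which has at most \<open>L\<close> elements.\<close>
    also have "card ({..<n} \<inter> {j. \<not> far i j}) \<le> card ({i..<i + L} \<union> {Suc i - L..<Suc i})"
      by (intro card_mono) (auto simp: far_def)
    also have "\<dots> \<le> L + L"
      by (rule order_trans[OF card_Un_le]) auto
    finally show ?thesis by simp
  qed
  then have "(\<Sum>i<n. \<Sum>j<n. of_bool (\<not> far i j)) \<le> (\<Sum>i<n. 2 * real L)"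
    by (intro sum_mono) auto
  then show ?thesis by (simp add: mult_ac)
qed

lemma integral_S: "(\<integral>p. S n p \<partial>\<mu>\<mu>) = real n ^ 2 * A"
  unfolding S_def using integrable_U by (simp add: integral_U power2_eq_square)

lemma S_measurable [measurable]: "S n \<in> borel_measurable \<mu>\<mu>"
  unfolding S_def by measurable

lemma S_power2: "S n p ^ 2 = (\<Sum>i<n. \<Sum>j<n. \<Sum>i'<n. \<Sum>j'<n. U i j p * U i' j' p)"
  unfolding S_def power2_eq_square sum_distrib_right unfolding sum_distrib_left ..

lemma A_nonneg: "0 \<le> A" and B_nonneg: "0 \<le> B"
  unfolding A_def B_def by (simp_all add: F_nonneg)

lemma integrable_S2: "integrable \<mu>\<mu> (\<lambda>p. S n p ^ 2)"
  unfolding S_power2 by (intro Bochner_Integration.integrable_sum integrable_UU)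

lemma integrable_S: "integrable \<mu>\<mu> (S n)"
  unfolding S_def by (intro Bochner_Integration.integrable_sum integrable_U)

lemma second_moment_S:
  "(\<integral>p. S n p ^ 2 \<partial>\<mu>\<mu>) \<le> real n ^ 4 * (A ^ 2 + 2 * \<epsilon>) + 4 * real L * real n ^ 3 * B + 4 * real L ^ 2 * real n ^ 2 * A"
proof -
  define N :: real where "N = (\<Sum>i<n. \<Sum>j<n. of_bool (\<not> far i j))"
  have N: "0 \<le> N" "N \<le> 2 * real L * real n"
    using near_pairs_le[of n] unfolding N_def by (auto intro!: sum_nonneg)
  have "(\<integral>p. S n p ^ 2 \<partial>\<mu>\<mu>) = (\<Sum>i<n. \<Sum>j<n. \<Sum>i'<n. \<Sum>j'<n. \<integral>p. U i j p * U i' j' p \<partial>\<mu>\<mu>)"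
    unfolding S_power2 by (simp add: Bochner_Integration.integral_sum Bochner_Integration.integrable_sum integrable_UU)
  also have "\<dots> \<le> (\<Sum>i<n. \<Sum>j<n. \<Sum>i'<n. \<Sum>j'<n. A ^ 2 + 2 * \<epsilon>
     + (of_bool (\<not> far i i') + of_bool (\<not> far j j')) * B + of_bool (\<not> far i i') * of_bool (\<not> far j j') * A)"
    by (intro sum_mono UU_le)
  \<comment> \<open>Grouping the times of each point makes the sum of products of indicators factorize.\<close>
  also have "\<dots> = (\<Sum>i<n. \<Sum>i'<n. \<Sum>j<n. \<Sum>j'<n. A ^ 2 + 2 * \<epsilon>
     + (of_bool (\<not> far i i') + of_bool (\<not> far j j')) * B + of_bool (\<not> far i i') * of_bool (\<not> far j j') * A)"
    by (intro sum.cong refl sum.swap)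
  also have "\<dots> = real n ^ 4 * (A ^ 2 + 2 * \<epsilon>) + 2 * real n ^ 2 * N * B + N ^ 2 * A"
  proof -
    have 1: "(\<Sum>i<n. \<Sum>i'<n. \<Sum>j<n. \<Sum>j'<n. c) = real n ^ 4 * c" for c :: real
      by (simp add: power4_eq_xxxx)
    have 2: "(\<Sum>i<n. \<Sum>i'<n. \<Sum>j<n. \<Sum>j'<n. f i i' * B) = real n ^ 2 * (\<Sum>i<n. \<Sum>i'<n. f i i') * B"
      and 3: "(\<Sum>i<n. \<Sum>i'<n. \<Sum>j<n. \<Sum>j'<n. f j j' * B) = real n ^ 2 * (\<Sum>i<n. \<Sum>i'<n. f i i') * B"
      for f :: "nat \<Rightarrow> nat \<Rightarrow> real"
      by (simp_all add: power2_eq_square sum_distrib_left sum_distrib_right mult_ac)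
    have 4: "(\<Sum>i<n. \<Sum>i'<n. \<Sum>j<n. \<Sum>j'<n. of_bool (\<not> far i i') * of_bool (\<not> far j j') * A) = N ^ 2 * A"
      unfolding N_def power2_eq_square mult.assoc sum_distrib_right unfolding sum_distrib_left ..
    show ?thesis
      unfolding sum.distrib distrib_right 1 2 3 4 N_def[symmetric] by (simp add: distrib_left)
  qed
  also have "\<dots> \<le> real n ^ 4 * (A ^ 2 + 2 * \<epsilon>) + 2 * real n ^ 2 * (2 * real L * real n) * B + (2 * real L * real n) ^ 2 * A"
    using N A_nonneg B_nonneg by (intro add_mono mult_right_mono mult_left_mono power_mono) auto
  also have "\<dots> = real n ^ 4 * (A ^ 2 + 2 * \<epsilon>) + 4 * real L * real n ^ 3 * B + 4 * real L ^ 2 * real n ^ 2 * A"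
    by (simp add: power2_eq_square power3_eq_cube)
  finally show ?thesis .
qed

text \<open>
  Chebyshev's inequality: \<open>S n = 0\<close> is a deviation of size \<open>n\<^sup>2 A\<close> from the mean.
\<close>

lemma prob_S_zero_le:
  assumes "0 < A" "0 < n"
  shows "measure \<mu>\<mu> {p. S n p = 0} \<le> 2 * \<epsilon> / A ^ 2 + 4 * real L * B / (real n * A ^ 2) + 4 * real L ^ 2 / (real n ^ 2 * A)"
proof -
  let ?m = "real n ^ 2 * A"
  have m: "0 < ?m" using assms by simp
  have "measure \<mu>\<mu> {p. S n p = 0} \<le> P.prob {p \<in> space \<mu>\<mu>. ?m \<le> \<bar>S n p - P.expectation (S n)\<bar>}"
  proof (rule P.P.finite_measure_mono)
    show "{p. S n p = 0} \<subseteq> {p \<in> space \<mu>\<mu>. ?m \<le> \<bar>S n p - P.expectation (S n)\<bar>}"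
      using m by (auto simp: integral_S)
  qed measurable
  also have "\<dots> \<le> P.variance (S n) / ?m ^ 2"
    by (rule P.P.Chebyshev_inequality) (auto simp: integrable_S2 m)
  also have "P.variance (S n) = (\<integral>p. S n p ^ 2 \<partial>\<mu>\<mu>) - ?m ^ 2"
    using P.P.variance_eq[OF integrable_S integrable_S2] by (simp add: integral_S)
  also have "\<dots> / ?m ^ 2 \<le> (2 * \<epsilon> * real n ^ 4 + 4 * real L * real n ^ 3 * B + 4 * real L ^ 2 * real n ^ 2 * A) / ?m ^ 2"
    using second_moment_S[of n] by (intro divide_right_mono) (auto simp: algebra_simps)
  also have "\<dots> = 2 * \<epsilon> / A ^ 2 + 4 * real L * B / (real n * A ^ 2) + 4 * real L ^ 2 / (real n ^ 2 * A)"
    using assms by (simp add: field_simps power_numeral_reduce)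
  finally show ?thesis .
qed

end

section \<open>Application to a Lipschitz approximation of closeness\<close>

lemma lipschitz_norm_le:
  fixes f :: "'a::metric_space \<Rightarrow> real"
  assumes "K-lipschitz_on UNIV f" "\<And>x. 0 \<le> f x \<and> f x \<le> 1"
  shows "lipschitz_norm f \<le> 1 + K" and "0 \<le> lipschitz_norm f"
proof -
  have K: "K \<in> {L. L-lipschitz_on UNIV f}" using assms by simp
  have bdd: "bdd_below {L. L-lipschitz_on UNIV f}"
    by (rule bdd_belowI[where m = 0]) (auto dest: lipschitz_on_nonneg)
  have "best_lipschitz f \<le> K" unfolding best_lipschitz_def
    by (rule cInf_lower[OF K bdd])
  moreover have "0 \<le> best_lipschitz f" unfolding best_lipschitz_def
    using K by (intro cInf_greatest) (auto dest: lipschitz_on_nonneg)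
  moreover have "(SUP x. \<bar>f x\<bar>) \<le> 1"
    using assms(2) by (intro cSUP_least) auto
  moreover have "0 \<le> (SUP x. \<bar>f x\<bar>)"
    using assms(2) by (intro cSUP_upper2[where x = undefined]) (auto intro!: bdd_aboveI[where M = 1])
  ultimately show "lipschitz_norm f \<le> 1 + K" "0 \<le> lipschitz_norm f"
    unfolding lipschitz_norm_def by auto
qed

definition bump :: "real \<Rightarrow> 'a::metric_space \<Rightarrow> 'a \<Rightarrow> real" where
  "bump r x y = max 0 (min 1 (2 - 2 / r * dist x y))"

lemma bump_lipschitz:
  assumes "0 < r"
  shows "(2 / r)-lipschitz_on UNIV (bump r x)"
proof (rule lipschitz_onI)
  fix y z :: 'a
  have "\<bar>bump r x y - bump r x z\<bar> \<le> \<bar>2 / r * dist x y - 2 / r * dist x z\<bar>"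
    unfolding bump_def by linarith
  also have "\<dots> = 2 / r * \<bar>dist x y - dist x z\<bar>"
    unfolding right_diff_distrib[symmetric] abs_mult using assms by simp
  also have "\<dots> \<le> 2 / r * dist y z"
    using assms abs_dist_diff_le[of y x z] by (intro mult_left_mono) (auto simp: dist_commute)
  finally show "dist (bump r x y) (bump r x z) \<le> 2 / r * dist y z"
    by (simp add: dist_real_def)
qed (use assms in auto)

lemma bump_eq_1: "0 < r \<Longrightarrow> dist x y \<le> r / 2 \<Longrightarrow> bump r x y = 1"
  by (simp add: bump_def field_simps)

lemma bump_eq_0: "0 < r \<Longrightarrow> r \<le> dist x y \<Longrightarrow> bump r x y = 0"
  by (simp add: bump_def field_simps)

lemma bump_bounds: "0 \<le> bump r x y" "bump r x y \<le> 1"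
  by (auto simp: bump_def)

context compact_mp_system
begin

text \<open>
  The second moment bound for the kernel \<open>bump r\<close>, which lies between the indicators of \<open>dist < r / 2\<close>
  and of \<open>dist < r\<close>. Hence \<open>corr (r / 2) \<le> A\<close>, and \<open>F \<le> sqrt (corr (2 * r))\<close> by the bound on the
  measure of balls. The latter gives \<open>B \<le> sqrt (corr (2 * r)) * A\<close>, a gain of a factor
  \<open>sqrt (corr (2 * r))\<close> over the trivial \<open>B \<le> A\<close>; with \<open>n \<approx> (corr r)\<^bsup>-1/2\<^esup>\<close> it is exactly the gain that
  makes the middle term small.
\<close>

lemma prob_orbits_apart_le:
  fixes c C r :: real and n L :: nat
  assumes C: "0 < C" and c: "0 < c" and r: "0 < r" and n: "0 < n"
    and mix: "\<And>f g n. is_lipschitz f \<Longrightarrow> is_lipschitz g \<Longrightarrow>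
      \<bar>(\<integral>x. f x * g ((T ^^ n) x) \<partial>\<mu>) - (\<integral>x. f x \<partial>\<mu>) * (\<integral>x. g x \<partial>\<mu>)\<bar>
         \<le> C * exp (- (real n powr c)) * lipschitz_norm f * lipschitz_norm g"
  shows "measure \<mu>\<mu> {p. \<not> (\<exists>i<n. \<exists>j<n. dist ((T ^^ i) (fst p)) ((T ^^ j) (snd p)) < r)} \<le>
    2 * (C * exp (- (real L powr c)) * (1 + 2 / r) ^ 2) / corr (r / 2) ^ 2
    + 4 * real L * sqrt (corr (2 * r)) / (real n * corr (r / 2))
    + 4 * real L ^ 2 / (real n ^ 2 * corr (r / 2))"
proof -
  define \<epsilon> where "\<epsilon> = C * exp (- (real L powr c)) * (1 + 2 / r) ^ 2"
  have \<epsilon>: "0 \<le> \<epsilon>" using C unfolding \<epsilon>_def by simp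
  interpret decorrelated_kernel \<mu> T "bump r" "2 / r" \<epsilon> L
  proof unfold_locales
    show "bump r x y = bump r y x" for x y :: 'a
      by (simp add: bump_def dist_commute)
    show "(\<lambda>p. bump r (fst p) (snd p)) \<in> borel_measurable \<mu>\<mu>"
      unfolding bump_def by measurable
  next
    fix f g :: "'a \<Rightarrow> real" and m :: nat
    assume m: "L \<le> m" and f: "(2 / r)-lipschitz_on UNIV f" "\<And>x. 0 \<le> f x \<and> f x \<le> 1"
      and g: "(2 / r)-lipschitz_on UNIV g" "\<And>x. 0 \<le> g x \<and> g x \<le> 1"
    have "(\<integral>x. f x * g ((T ^^ m) x) \<partial>\<mu>) - (\<integral>x. f x \<partial>\<mu>) * (\<integral>x. g x \<partial>\<mu>)
       \<le> C * exp (- (real m powr c)) * lipschitz_norm f * lipschitz_norm g"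
      using f g by (intro order_trans[OF abs_ge_self mix]) (auto simp: is_lipschitz_def)
    also have "\<dots> \<le> C * exp (- (real L powr c)) * (1 + 2 / r) * (1 + 2 / r)"
      using m c C r lipschitz_norm_le[OF f] lipschitz_norm_le[OF g]
      by (intro mult_mono) (auto intro!: powr_mono2 mult_nonneg_nonneg)
    also have "\<dots> = \<epsilon>" by (simp add: \<epsilon>_def power2_eq_square)
    finally show "(\<integral>x. f x * g ((T ^^ m) x) \<partial>\<mu>) \<le> (\<integral>x. f x \<partial>\<mu>) * (\<integral>x. g x \<partial>\<mu>) + \<epsilon>"
      by simp
  qed (rule bump_bounds bump_lipschitz[OF r] \<epsilon>)+
  have "corr (r / 2) = (\<integral>p. indicator {p. dist (fst p) (snd p) < r / 2} p \<partial>\<mu>\<mu>)"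
    by (subst measure_near_diagonal[symmetric]) simp
  also have "\<dots> \<le> (\<integral>p. U 0 0 p \<partial>\<mu>\<mu>)"
  proof (rule integral_mono)
    show "integrable \<mu>\<mu> (indicator {p. dist (fst p) (snd p) < r / 2} :: _ \<Rightarrow> real)"
      by (intro integrable_real_indicator near_diagonal_measurable) (simp add: P.P.emeasure_eq_measure)
    show "indicator {p. dist (fst p) (snd p) < r / 2} p \<le> U 0 0 p" for p
      using r by (simp add: indicator_def U_def bump_eq_1 bump_bounds)
  qed (rule integrable_U)
  finally have A: "corr (r / 2) \<le> A" by (simp add: integral_U)
  have pos: "0 < corr (r / 2)" using corr_pos r by simp
  have F: "F y \<le> sqrt (corr (2 * r))" for y
  proof -
    have "F y \<le> (\<integral>x. indicator (ball y r) x \<partial>\<mu>)"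
      unfolding F_def
    proof (rule integral_mono)
      show "integrable \<mu> (indicator (ball y r) :: _ \<Rightarrow> real)"
        by (intro integrable_real_indicator ball_sets) (simp add: emeasure_eq_measure)
      show "bump r y x \<le> indicator (ball y r) x" for x
        using r by (simp add: indicator_def bump_eq_0 bump_bounds)
    qed (rule integrable_h)
    also have "\<dots> \<le> sqrt (corr (2 * r))"
      using measure_ball_power2_le[of y r] by (simp add: real_le_rsqrt)
    finally show ?thesis .
  qed
  have "integrable \<mu> F"
    by (rule integrable_const_bound[where B = 1]) (auto simp: F_abs)
  then have "B \<le> (\<integral>y. sqrt (corr (2 * r)) * F y \<partial>\<mu>)"
    unfolding B_def using integrable_F2[of 0] F F_nonneg
    by (intro integral_mono) (auto simp: power2_eq_square intro!: mult_right_mono)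
  then have B: "B \<le> sqrt (corr (2 * r)) * A" by (simp add: A_def)
  have "measure \<mu>\<mu> {p. \<not> (\<exists>i<n. \<exists>j<n. dist ((T ^^ i) (fst p)) ((T ^^ j) (snd p)) < r)} \<le> measure \<mu>\<mu> {p. S n p = 0}"
  proof (rule P.P.finite_measure_mono)
    have "{p \<in> space \<mu>\<mu>. S n p = 0} \<in> sets \<mu>\<mu>" by measurable
    then show "{p. S n p = 0} \<in> sets \<mu>\<mu>" by simp
    show "{p. \<not> (\<exists>i<n. \<exists>j<n. dist ((T ^^ i) (fst p)) ((T ^^ j) (snd p)) < r)} \<subseteq> {p. S n p = 0}"
    proof (intro subsetI CollectI)
      fix p assume "p \<in> {p. \<not> (\<exists>i<n. \<exists>j<n. dist ((T ^^ i) (fst p)) ((T ^^ j) (snd p)) < r)}"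
      then have "r \<le> dist ((T ^^ i) (fst p)) ((T ^^ j) (snd p))" if "i < n" "j < n" for i j
        using that not_less by blast
      then show "S n p = 0" by (simp add: S_def U_def bump_eq_0[OF r])
    qed
  qed
  also have "\<dots> \<le> 2 * \<epsilon> / A ^ 2 + 4 * real L * B / (real n * A ^ 2) + 4 * real L ^ 2 / (real n ^ 2 * A)"
    using A pos n by (intro prob_S_zero_le) auto
  also have "\<dots> \<le> 2 * \<epsilon> / corr (r / 2) ^ 2 + 4 * real L * sqrt (corr (2 * r)) / (real n * corr (r / 2))
     + 4 * real L ^ 2 / (real n ^ 2 * corr (r / 2))"
  proof (intro add_mono)
    show "2 * \<epsilon> / A ^ 2 \<le> 2 * \<epsilon> / corr (r / 2) ^ 2"
      using A pos \<epsilon> by (intro divide_left_mono power_mono mult_pos_pos) auto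
    show "4 * real L ^ 2 / (real n ^ 2 * A) \<le> 4 * real L ^ 2 / (real n ^ 2 * corr (r / 2))"
      using A pos n by (intro divide_left_mono mult_left_mono mult_pos_pos) auto
    have "4 * real L * B / (real n * A ^ 2) \<le> 4 * real L * (sqrt (corr (2 * r)) * A) / (real n * A ^ 2)"
      using B n by (intro divide_right_mono mult_left_mono) auto
    also have "\<dots> = 4 * real L * sqrt (corr (2 * r)) / (real n * A)"
      using A pos by (simp add: power2_eq_square)
    also have "\<dots> \<le> 4 * real L * sqrt (corr (2 * r)) / (real n * corr (r / 2))"
      using A pos n order_less_imp_le[OF corr_pos[of "2 * r"]] r
      by (intro divide_left_mono mult_left_mono mult_pos_pos mult_nonneg_nonneg) auto
    finally show "4 * real L * B / (real n * A ^ 2) \<le> 4 * real L * sqrt (corr (2 * r)) / (real n * corr (r / 2))" .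
  qed
  finally show ?thesis unfolding \<epsilon>_def .
qed

end

section \<open>Almost sure statements along dyadic times\<close>

text \<open>
  Along powers of two polynomially small probabilities are summable, and the monotonicity of the
  minimal distance carries bounds from two consecutive powers to the times in between, at the cost of
  a factor 2 in the time that does not affect exponents.
\<close>

lemma eventually_between_dyadic:
  assumes "\<forall>\<^sub>F k in sequentially. P (2 ^ k)"
  shows "\<forall>\<^sub>F n in sequentially. \<exists>m. m \<le> n \<and> n < 2 * m \<and> P m \<and> P (2 * m)"
proof -
  obtain k0 where k0: "\<And>k. k0 \<le> k \<Longrightarrow> P (2 ^ k)"
    using assms unfolding eventually_sequentially by auto
  have "\<exists>m. m \<le> n \<and> n < 2 * m \<and> P m \<and> P (2 * m)" if n: "2 ^ k0 \<le> n" for n :: nat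
  proof -
    have "1 \<le> n" using n one_le_power[of "2::nat" k0] by linarith
    then obtain k where k: "2 ^ k \<le> n" "n < 2 ^ (k + 1)"
      using ex_power_ivl1[of 2 n] by auto
    have "(2::nat) ^ k0 < 2 ^ (k + 1)" using n k(2) by linarith
    then have "k0 \<le> k" using power_less_imp_less_exp[of "2::nat" k0 "k + 1"] by simp
    then show ?thesis using k k0[of k] k0[of "Suc k"] by (intro exI[of _ "2 ^ k"]) auto
  qed
  then show ?thesis unfolding eventually_sequentially by blast
qed

lemma (in finite_measure) AE_eventually_dyadic:
  assumes E: "\<And>n. E n \<in> sets M" and "0 < \<kappa>"
    and O: "(\<lambda>n. measure M (E n)) \<in> O(\<lambda>n. real n powr (- \<kappa>))"
  shows "AE x in M. \<forall>\<^sub>F k in sequentially. x \<notin> E (2 ^ k)"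
proof -
  have geometric: "norm (2 powr (- \<kappa>)) < 1" using \<open>0 < \<kappa>\<close> by (simp add: powr_less_one)
  have "filterlim (\<lambda>k. 2 ^ k :: nat) sequentially sequentially"
    by (rule filterlim_subseq) (simp add: strict_mono_def)
  then have "(\<lambda>k. measure M (E (2 ^ k))) \<in> O(\<lambda>k. real (2 ^ k) powr (- \<kappa>))"
    using landau_o.big.compose[OF O] by blast
  moreover have "real (2 ^ k) powr (- \<kappa>) = (2 powr (- \<kappa>)) ^ k" for k
    by (simp add: powr_realpow[symmetric] powr_powr mult.commute)
  ultimately have "(\<lambda>k. measure M (E (2 ^ k))) \<in> O(\<lambda>k. (2 powr (- \<kappa>)) ^ k)" by simp
  moreover have "summable (\<lambda>k. norm ((2 powr (- \<kappa>)) ^ k))"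
    unfolding norm_power using geometric by (intro summable_geometric) simp
  ultimately have "summable (\<lambda>k. measure M (E (2 ^ k)))"
    by (rule summable_comparison_test_bigo[rotated])
  then have "AE x in M. \<forall>\<^sub>F k in sequentially. x \<in> space M - E (2 ^ k)"
    by (intro borel_cantelli_AE1 E) (auto simp: emeasure_eq_measure)
  then show ?thesis by eventually_elim (erule eventually_mono, simp)
qed

section \<open>Polynomial decay of the second moment bound\<close>

text \<open>
  Here \<open>m\<close> stands for the correlation integral, with \<open>r\<^sup>b \<le> m r \<le> r\<^sup>a\<close>, and the radius at time \<open>n\<close> is
  \<open>n powr (- s)\<close>. With the gap \<open>L = n powr \<delta>\<close> the mixing error \<open>exp (- L powr c)\<close> beats every power of
  \<open>n\<close>, and the other two terms are powers of \<open>n\<close> with the exponents in the hypotheses. For \<open>a\<close> and \<open>b\<close>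
  near \<open>D\<close> and small \<open>\<delta>\<close>, these exponents are near \<open>s * D / 2 - 1\<close> and \<open>s * D - 2\<close>: this is where the
  critical value \<open>s = 2 / D\<close> comes from.
\<close>

lemma second_moment_bound_decay:
  fixes c C s \<delta> \<kappa> a b :: real
  assumes pos: "0 < c" "0 < C" "0 < s" "0 < \<delta>" "0 < \<kappa>"
    and exponents: "\<delta> - 1 + s * b - s * a / 2 \<le> - \<kappa>" "2 * \<delta> - 2 + s * b \<le> - \<kappa>"
    and m_nonneg: "\<And>r. 0 \<le> m r"
    and lower: "\<forall>\<^sub>F r in at_right 0. r powr b \<le> m r"
    and upper: "\<forall>\<^sub>F r in at_right 0. m r \<le> r powr a"
  defines "L n \<equiv> nat \<lceil>real n powr \<delta>\<rceil>" and "\<rho> n \<equiv> real n powr (- s)"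
  shows "(\<lambda>n. 2 * (C * exp (- (real (L n) powr c)) * (1 + 2 / \<rho> n) ^ 2) / m (\<rho> n / 2) ^ 2
      + 4 * real (L n) * sqrt (m (2 * \<rho> n)) / (real n * m (\<rho> n / 2))
      + 4 * real (L n) ^ 2 / (real n ^ 2 * m (\<rho> n / 2))) \<in> O(\<lambda>n. real n powr (- \<kappa>))" (is "?f \<in> _")
proof -
  have "filterlim (\<lambda>n. \<rho> n / 2) (at_right 0) sequentially"
    and "filterlim (\<lambda>n. 2 * \<rho> n) (at_right 0) sequentially"
    using pos unfolding \<rho>_def by real_asymp+
  then have ev: "\<forall>\<^sub>F n in sequentially. (\<rho> n / 2) powr b \<le> m (\<rho> n / 2)"
    "\<forall>\<^sub>F n in sequentially. m (2 * \<rho> n) \<le> (2 * \<rho> n) powr a"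
    by (auto intro: eventually_compose_filterlim[OF lower] eventually_compose_filterlim[OF upper])
  define g1 where "g1 n = 2 * (C * exp (- ((real n powr \<delta>) powr c)) * (1 + 2 / \<rho> n) ^ 2) / ((\<rho> n / 2) powr b) ^ 2" for n
  define g2 where "g2 n = 4 * (2 * real n powr \<delta>) * sqrt ((2 * \<rho> n) powr a) / (real n * (\<rho> n / 2) powr b)" for n
  define g3 where "g3 n = 4 * (2 * real n powr \<delta>) ^ 2 / (real n ^ 2 * (\<rho> n / 2) powr b)" for n
  have "?f \<in> O(\<lambda>n. g1 n + g2 n + g3 n)"
  proof (rule bigoI[where c = 1])
    show "\<forall>\<^sub>F n in sequentially. norm (?f n) \<le> 1 * norm (g1 n + g2 n + g3 n)"
      using ev eventually_gt_at_top[of 0]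
    proof eventually_elim
      case (elim n)
      have \<rho>: "0 < \<rho> n" using elim by (simp add: \<rho>_def)
      have m: "0 < (\<rho> n / 2) powr b" "0 < m (\<rho> n / 2)"
        using \<rho> elim(1) by (auto intro: less_le_trans[of 0 "(\<rho> n / 2) powr b"])
      have n1: "1 \<le> real n powr \<delta>" using elim pos by (intro ge_one_powr_ge_zero) auto
      have L1: "real n powr \<delta> \<le> real (L n)" unfolding L_def by (rule real_nat_ceiling_ge)
      have L2: "real (L n) \<le> 2 * real n powr \<delta>"
        using n1 unfolding L_def by linarith
      have 1: "2 * (C * exp (- (real (L n) powr c)) * (1 + 2 / \<rho> n) ^ 2) / m (\<rho> n / 2) ^ 2 \<le> g1 n"
        unfolding g1_def using pos m elim(1) L1
        by (intro frac_le mult_left_mono mult_right_mono power_mono) (auto intro!: powr_mono2)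
      have 2: "4 * real (L n) * sqrt (m (2 * \<rho> n)) / (real n * m (\<rho> n / 2)) \<le> g2 n"
        unfolding g2_def using m elim L2
        by (intro frac_le mult_mono mult_pos_pos) (auto simp: m_nonneg)
      have 3: "4 * real (L n) ^ 2 / (real n ^ 2 * m (\<rho> n / 2)) \<le> g3 n"
        unfolding g3_def using m elim L2
        by (intro frac_le mult_mono power_mono mult_pos_pos) auto
      have dominate: "norm (x + y + z) \<le> 1 * norm (u + v + w)"
        if "0 \<le> x" "0 \<le> y" "0 \<le> z" "x \<le> u" "y \<le> v" "z \<le> w" for x y z u v w :: real
        using that by simp
      show ?case
        by (rule dominate[OF _ _ _ 1 2 3]) (use pos m_nonneg in auto)
    qed
  qed
  have powr_bigo: "(\<lambda>n. real n powr e) \<in> O(\<lambda>n. real n powr f)" if "e \<le> f" for e f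
  proof (rule bigoI[where c = 1])
    show "\<forall>\<^sub>F n in sequentially. norm (real n powr e) \<le> 1 * norm (real n powr f)"
      using eventually_ge_at_top[of 1] by eventually_elim (use that in \<open>auto intro: powr_mono\<close>)
  qed
  note \<open>?f \<in> O(\<lambda>n. g1 n + g2 n + g3 n)\<close>
  also have "(\<lambda>n. g1 n + g2 n + g3 n) \<in> O(\<lambda>n. real n powr (- \<kappa>))"
  proof (intro sum_in_bigo)
    show "g1 \<in> O(\<lambda>n. real n powr (- \<kappa>))"
      unfolding g1_def \<rho>_def using pos by real_asymp
    have "g2 \<in> O(\<lambda>n. real n powr (\<delta> - 1 + s * b - s * a / 2))"
      unfolding g2_def \<rho>_def using pos by real_asymp
    also have "(\<lambda>n. real n powr (\<delta> - 1 + s * b - s * a / 2)) \<in> O(\<lambda>n. real n powr (- \<kappa>))"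
      by (rule powr_bigo[OF exponents(1)])
    finally show "g2 \<in> O(\<lambda>n. real n powr (- \<kappa>))" .
    have "g3 \<in> O(\<lambda>n. real n powr (2 * \<delta> - 2 + s * b))"
      unfolding g3_def \<rho>_def using pos by real_asymp
    also have "(\<lambda>n. real n powr (2 * \<delta> - 2 + s * b)) \<in> O(\<lambda>n. real n powr (- \<kappa>))"
      by (rule powr_bigo[OF exponents(2)])
    finally show "g3 \<in> O(\<lambda>n. real n powr (- \<kappa>))" .
  qed
  finally show ?thesis .
qed

section \<open>Almost sure upper and lower bounds\<close>

lemma eventually_at_right_0_between_0_1: "\<forall>\<^sub>F r::real in at_right 0. 0 < r \<and> r < 1"
  by (rule eventually_at_rightI[of 0 1]) auto

context compact_mp_system
begin

text \<open>
  For \<open>0 < r < 1\<close> the logarithm of \<open>r\<close> is negative, so lower bounds on the correlation ratio are upper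
  bounds on \<open>corr r\<close> and conversely.
\<close>

lemma corr_le_powr:
  assumes D: "((\<lambda>r. ereal (correlation_ratio \<mu> r)) \<longlongrightarrow> D) (at_right 0)" and a: "ereal a < D"
  shows "\<forall>\<^sub>F r in at_right 0. corr r \<le> r powr a"
proof -
  from eventually_at_right_0_between_0_1 order_tendstoD(1)[OF D a] show ?thesis
  proof eventually_elim
    case (elim r)
    then have "ln (corr r) \<le> a * ln r"
      by (simp add: correlation_ratio_def field_simps)
    then have "ln (corr r) \<le> ln (r powr a)" using elim by (simp add: ln_powr)
    then show ?case using elim corr_pos[of r] by (subst (asm) ln_le_cancel_iff) auto
  qed
qed

lemma corr_ge_powr:
  assumes D: "((\<lambda>r. ereal (correlation_ratio \<mu> r)) \<longlongrightarrow> D) (at_right 0)" and b: "D < ereal b"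
  shows "\<forall>\<^sub>F r in at_right 0. r powr b \<le> corr r"
proof -
  from eventually_at_right_0_between_0_1 order_tendstoD(2)[OF D b] show ?thesis
  proof eventually_elim
    case (elim r)
    then have "b * ln r \<le> ln (corr r)"
      by (simp add: correlation_ratio_def field_simps)
    then have "ln (r powr b) \<le> ln (corr r)" using elim by (simp add: ln_powr)
    then show ?case using elim corr_pos[of r] by (subst (asm) ln_le_cancel_iff) auto
  qed
qed

lemma correlation_dimension_nonneg:
  assumes D: "((\<lambda>r. ereal (correlation_ratio \<mu> r)) \<longlongrightarrow> D) (at_right 0)"
  shows "0 \<le> D"
proof (rule tendsto_lowerbound[OF D])
  from eventually_at_right_0_between_0_1 show "\<forall>\<^sub>F r in at_right 0. 0 \<le> ereal (correlation_ratio \<mu> r)"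
  proof eventually_elim
    case (elim r)
    have "ln (corr r) \<le> 0" "ln r \<le> 0" using elim corr_le_1[of r] corr_pos[of r] by auto
    then show ?case by (simp add: correlation_ratio_def divide_nonpos_nonpos)
  qed
qed simp

text \<open>
  The first moment: at radius \<open>n powr (- t)\<close> with \<open>t > 2 / D\<close> a coincidence before time \<open>n\<close> has
  probability at most \<open>n\<^sup>2 * n powr (- t * a)\<close>, where \<open>a < D\<close> can be chosen such that \<open>t * a > 2\<close>.
\<close>

lemma AE_limsup_le:
  assumes D: "((\<lambda>r. ereal (correlation_ratio \<mu> r)) \<longlongrightarrow> D) (at_right 0)" and q: "2 / D < ereal q"
  shows "AE p in \<mu>\<mu>. \<forall>\<^sub>F n in sequentially.
    neg_log (orbit_min_dist T n (fst p) (snd p)) / ereal (ln (real n)) \<le> ereal q"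
proof -
  note D0 = correlation_dimension_nonneg[OF D]
  obtain t where t: "2 / D < ereal t" "t < q" using ereal_dense2[OF q] by auto
  have "0 < t \<and> ereal (2 / t) < D"
  proof (cases D)
    case (real d)
    then have "0 < d" "2 < d * t" using t(1) D0 by (auto simp: field_simps split: if_splits)
    moreover from this have "0 < t" using zero_less_mult_pos[of d t] by simp
    ultimately show ?thesis using real by (simp add: field_simps)
  qed (use t(1) D0 in auto)
  then have t0: "0 < t" and tD: "ereal (2 / t) < D" by auto
  obtain a where a: "2 / t < a" "ereal a < D" using ereal_dense2[OF tD] by auto
  define E where "E n = {p. \<exists>i<n. \<exists>j<n. dist ((T ^^ i) (fst p)) ((T ^^ j) (snd p)) < real n powr (- t)}" for n
  define \<kappa> where "\<kappa> = t * a - 2"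
  have \<kappa>: "0 < \<kappa>" using a(1) t0 by (simp add: \<kappa>_def field_simps)
  have "filterlim (\<lambda>n. real n powr (- t)) (at_right 0) sequentially"
    using t0 by real_asymp
  then have "\<forall>\<^sub>F n in sequentially. corr (real n powr (- t)) \<le> (real n powr (- t)) powr a"
    by (rule eventually_compose_filterlim[OF corr_le_powr[OF D a(2)]])
  with eventually_gt_at_top[of 0]
  have "\<forall>\<^sub>F n in sequentially. norm (measure \<mu>\<mu> (E n)) \<le> 1 * norm (real n powr (- \<kappa>))"
  proof eventually_elim
    case (elim n)
    have "measure \<mu>\<mu> (E n) \<le> real n ^ 2 * corr (real n powr (- t))"
      unfolding E_def by (rule prob_orbits_close_le)
    also have "\<dots> \<le> real n ^ 2 * (real n powr (- t)) powr a"
      using elim by (intro mult_left_mono) auto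
    also have "\<dots> = real n powr 2 * real n powr (- t * a)"
      using elim by (simp add: powr_powr)
    also have "\<dots> = real n powr (- \<kappa>)"
      unfolding powr_add[symmetric] by (simp add: \<kappa>_def)
    finally show ?case by simp
  qed
  then have "(\<lambda>n. measure \<mu>\<mu> (E n)) \<in> O(\<lambda>n. real n powr (- \<kappa>))"
    by (rule bigoI)
  then have "AE p in \<mu>\<mu>. \<forall>\<^sub>F k in sequentially. p \<notin> E (2 ^ k)"
    using \<kappa> by (intro P.P.AE_eventually_dyadic) (auto simp: E_def)
  then show ?thesis
  proof eventually_elim
    case (elim p)
    have "\<forall>\<^sub>F n in sequentially. real n powr (- q) \<le> (2 * real n) powr (- t)"
      using t(2) t0 by real_asymp
    with eventually_between_dyadic[of "\<lambda>m. p \<notin> E m", OF elim] eventually_ge_at_top[of 2]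
    show ?case
    proof eventually_elim
      case (elim n)
      then obtain m where m: "m \<le> n" "n < 2 * m" "p \<notin> E (2 * m)" by auto
      have "real n powr (- q) \<le> (2 * real n) powr (- t)" by (rule elim)
      also have "\<dots> \<le> real (2 * m) powr (- t)"
        using m t0 by (intro powr_mono2') auto
      also have "\<dots> \<le> orbit_min_dist T (2 * m) (fst p) (snd p)"
        using m(3) m(2) orbit_min_dist_less_iff[of "2 * m" T] by (simp add: E_def not_less flip: not_less)
      also have "\<dots> \<le> orbit_min_dist T n (fst p) (snd p)"
        using m elim(2) by (intro orbit_min_dist_antimono) auto
      finally show ?case using elim(2) by (intro neg_log_ratio_le) auto
    qed
  qed
qed

text \<open>
  For negative \<open>q\<close> it suffices that the minimal distance stays bounded. This settles the case
  \<open>D = \<infinity>\<close>, where \<open>2 / D = 0\<close>.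
\<close>

lemma neg_log_ratio_ge_of_neg:
  assumes "q < 0"
  shows "\<forall>\<^sub>F n in sequentially.
    ereal q \<le> neg_log (orbit_min_dist T n x y) / ereal (ln (real n))"
proof -
  have "filterlim (\<lambda>n. real n powr (- q)) at_top sequentially"
    using assms by real_asymp
  then have "\<forall>\<^sub>F n in sequentially. orbit_min_dist T 1 x y \<le> real n powr (- q)"
    by (simp add: filterlim_at_top)
  with eventually_ge_at_top[of 2] show ?thesis
  proof eventually_elim
    case (elim n)
    then have "orbit_min_dist T n x y \<le> real n powr (- q)"
      using orbit_min_dist_antimono[of 1 n T x y] by simp
    then show ?case using elim by (intro neg_log_ratio_ge orbit_min_dist_nonneg) auto
  qed
qed

text \<open>
  The second moment, at radius \<open>n powr (- s)\<close> with \<open>q < s < 2 / D\<close>.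
\<close>

lemma AE_liminf_ge:
  assumes D: "((\<lambda>r. ereal (correlation_ratio \<mu> r)) \<longlongrightarrow> D) (at_right 0)" and q: "ereal q < 2 / D"
    and "mixes_stretched_exponentially \<mu> T"
  shows "AE p in \<mu>\<mu>. \<forall>\<^sub>F n in sequentially.
    ereal q \<le> neg_log (orbit_min_dist T n (fst p) (snd p)) / ereal (ln (real n))"
proof (cases "q < 0")
  case True
  then show ?thesis by (simp add: neg_log_ratio_ge_of_neg)
next
  case False
  note D0 = correlation_dimension_nonneg[OF D]
  obtain c C :: real where c: "0 < c" and C: "0 < C"
    and mix: "\<And>f g n. is_lipschitz f \<Longrightarrow> is_lipschitz g \<Longrightarrow>
      \<bar>(\<integral>x. f x * g ((T ^^ n) x) \<partial>\<mu>) - (\<integral>x. f x \<partial>\<mu>) * (\<integral>x. g x \<partial>\<mu>)\<bar>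
         \<le> C * exp (- (real n powr c)) * lipschitz_norm f * lipschitz_norm g"
    using assms(3) unfolding mixes_stretched_exponentially_def by blast
  obtain s where s: "q < s" "ereal s < 2 / D" using ereal_dense2[OF q] by auto
  have s0: "0 < s" using False s by simp
  have "D \<noteq> \<infinity>" using s s0 by auto
  then obtain d where d: "D = ereal d" "0 \<le> d" using D0 by (cases D) auto
  have sd: "s * d < 2"
    using s(2) s0 d by (cases "d = 0") (auto simp: field_simps)
  \<comment> \<open>\<open>s * d / 2 = 1 - 4 * \<kappa>\<close>; of this room below 1, \<open>\<kappa>\<close> is spent on the gap \<open>L\<close> and, through \<open>\<eta>\<close>,
    \<open>3 * \<kappa> / 2\<close> on the error in the exponent of \<open>corr\<close>. The two exponents of the decay lemma become
    \<open>- 3 * \<kappa> / 2\<close> and \<open>- 5 * \<kappa>\<close>.\<close>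
  define \<kappa> where "\<kappa> = (1 - s * d / 2) / 4"
  define \<eta> where "\<eta> = \<kappa> / s"
  have \<kappa>: "0 < \<kappa>" using sd by (simp add: \<kappa>_def)
  have \<eta>: "0 < \<eta>" "s * \<eta> = \<kappa>" using \<kappa> s0 by (auto simp: \<eta>_def)
  define E where "E n = {p. \<not> (\<exists>i<n. \<exists>j<n. dist ((T ^^ i) (fst p)) ((T ^^ j) (snd p)) < real n powr (- s))}" for n
  define L where "L n = nat \<lceil>real n powr \<kappa>\<rceil>" for n
  let ?bound = "\<lambda>n. let r = real n powr (- s) in
    2 * (C * exp (- (real (L n) powr c)) * (1 + 2 / r) ^ 2) / corr (r / 2) ^ 2
    + 4 * real (L n) * sqrt (corr (2 * r)) / (real n * corr (r / 2))
    + 4 * real (L n) ^ 2 / (real n ^ 2 * corr (r / 2))"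
  have "(\<lambda>n. measure \<mu>\<mu> (E n)) \<in> O(?bound)"
  proof (rule bigoI[where c = 1])
    show "\<forall>\<^sub>F n in sequentially. norm (measure \<mu>\<mu> (E n)) \<le> 1 * norm (?bound n)"
      using eventually_gt_at_top[of 0]
    proof eventually_elim
      case (elim n)
      have "measure \<mu>\<mu> (E n) \<le> ?bound n"
        unfolding E_def Let_def using elim by (intro prob_orbits_apart_le C c mix) auto
      then show ?case by simp
    qed
  qed
  also have "?bound \<in> O(\<lambda>n. real n powr (- (\<kappa> / 2)))"
    unfolding Let_def L_def
  proof (rule second_moment_bound_decay)
    show "\<kappa> - 1 + s * (d + \<eta>) - s * (d - \<eta>) / 2 \<le> - (\<kappa> / 2)"
      and "2 * \<kappa> - 2 + s * (d + \<eta>) \<le> - (\<kappa> / 2)"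
      unfolding distrib_left right_diff_distrib \<eta>(2) using \<kappa> by (auto simp: \<kappa>_def field_simps)
    show "\<forall>\<^sub>F r in at_right 0. r powr (d + \<eta>) \<le> corr r"
      using \<eta> d by (intro corr_ge_powr[OF D]) simp
    show "\<forall>\<^sub>F r in at_right 0. corr r \<le> r powr (d - \<eta>)"
      using \<eta> d by (intro corr_le_powr[OF D]) simp
  qed (use c C s0 \<kappa> in auto)
  finally have "(\<lambda>n. measure \<mu>\<mu> (E n)) \<in> O(\<lambda>n. real n powr (- (\<kappa> / 2)))" .
  moreover have "E n \<in> sets \<mu>\<mu>" for n
    unfolding E_def Collect_neg_eq
    by (simp add: Compl_eq_Diff_UNIV sets.compl_sets[of _ \<mu>\<mu>, simplified])
  ultimately have "AE p in \<mu>\<mu>. \<forall>\<^sub>F k in sequentially. p \<notin> E (2 ^ k)"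
    using \<kappa> by (intro P.P.AE_eventually_dyadic[where \<kappa> = "\<kappa> / 2"]) auto
  then show ?thesis
  proof eventually_elim
    case (elim p)
    have "\<forall>\<^sub>F n in sequentially. (real n / 2) powr (- s) \<le> real n powr (- q)"
      using s s0 by real_asymp
    with eventually_between_dyadic[of "\<lambda>m. p \<notin> E m", OF elim] eventually_ge_at_top[of 2]
    show ?case
    proof eventually_elim
      case (elim n)
      then obtain m where m: "m \<le> n" "n < 2 * m" "p \<notin> E m" by auto
      have "orbit_min_dist T n (fst p) (snd p) \<le> orbit_min_dist T m (fst p) (snd p)"
        using m by (intro orbit_min_dist_antimono) auto
      also have "\<dots> \<le> real m powr (- s)"
        using m orbit_min_dist_less_iff[of m T "fst p" "snd p"] by (intro less_imp_le) (auto simp: E_def)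
      also have "\<dots> \<le> (real n / 2) powr (- s)"
        using m s0 elim(2) by (intro powr_mono2') auto
      also have "\<dots> \<le> real n powr (- q)" by (rule elim)
      finally show ?case using elim(2) by (intro neg_log_ratio_ge orbit_min_dist_nonneg) auto
    qed
  qed
qed

end

theorem theorem1p2:
  fixes T :: "'a::metric_space \<Rightarrow> 'a" and \<mu> :: "'a measure"
  assumes "compact (UNIV :: 'a set)"
    and "bounded_local_complexity TYPE('a)"
    and "is_lipschitz T"
    and "prob_space \<mu>" and "sets \<mu> = sets borel"
    and "distr \<mu> \<mu> T = \<mu>"
    and "correlation_dimension_well_defined \<mu>"
    and "mixes_stretched_exponentially \<mu> T"
  shows "AE (x, y) in \<mu> \<Otimes>\<^sub>M \<mu>.
           (\<lambda>n. neg_log (orbit_min_dist T n x y) / ereal (ln (real n)))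
             \<longlonglongrightarrow> 2 / correlation_dimension \<mu>"
proof -
  interpret prob_space \<mu> by fact
  have "continuous_on UNIV T"
    using \<open>is_lipschitz T\<close> lipschitz_on_continuous_on unfolding is_lipschitz_def by blast
  then have "T \<in> measurable \<mu> \<mu>"
    using borel_measurable_continuous_onI measurable_cong_sets \<open>sets \<mu> = sets borel\<close> by blast
  then interpret compact_mp_system \<mu> T
    using assms by unfold_locales auto
  obtain D where D: "((\<lambda>r. ereal (correlation_ratio \<mu> r)) \<longlongrightarrow> D) (at_right 0)"
    using assms(7) unfolding correlation_dimension_well_defined_def by blast
  have dim: "correlation_dimension \<mu> = D"
    unfolding correlation_dimension_def by (intro tendsto_Lim D) simp
  let ?R = "\<lambda>p n. neg_log (orbit_min_dist T n (fst p) (snd p)) / ereal (ln (real n))"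
  \<comment> \<open>Rational exponents suffice, which makes the exceptional sets countable in number.\<close>
  have "AE p in \<mu>\<mu>. 2 / D < ereal (of_rat q) \<longrightarrow> (\<forall>\<^sub>F n in sequentially. ?R p n \<le> ereal (of_rat q))" for q
    using AE_limsup_le[OF D, of "of_rat q"] by (cases "2 / D < ereal (of_rat q)") auto
  then have upper: "AE p in \<mu>\<mu>. \<forall>q. 2 / D < ereal (of_rat q) \<longrightarrow> (\<forall>\<^sub>F n in sequentially. ?R p n \<le> ereal (of_rat q))"
    by (simp add: AE_all_countable)
  have "AE p in \<mu>\<mu>. ereal (of_rat q) < 2 / D \<longrightarrow> (\<forall>\<^sub>F n in sequentially. ereal (of_rat q) \<le> ?R p n)" for q
    using AE_liminf_ge[OF D, of "of_rat q"] assms(8) by (cases "ereal (of_rat q) < 2 / D") auto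
  then have lower: "AE p in \<mu>\<mu>. \<forall>q. ereal (of_rat q) < 2 / D \<longrightarrow> (\<forall>\<^sub>F n in sequentially. ereal (of_rat q) \<le> ?R p n)"
    by (simp add: AE_all_countable)
  from upper lower have "AE p in \<mu>\<mu>. ?R p \<longlonglongrightarrow> 2 / D"
  proof eventually_elim
    case (elim p)
    show ?case
    proof (rule order_tendstoI)
      fix a assume "a < 2 / D"
      then obtain q where q: "a < ereal (of_rat q)" "ereal (of_rat q) < 2 / D" using ereal_dense3 by blast
      then have "\<forall>\<^sub>F n in sequentially. ereal (of_rat q) \<le> ?R p n" using elim(2) by blast
      then show "\<forall>\<^sub>F n in sequentially. a < ?R p n"
        by (rule eventually_mono) (rule less_le_trans[OF q(1)])
    next
      fix b assume "2 / D < b"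
      then obtain q where q: "2 / D < ereal (of_rat q)" "ereal (of_rat q) < b" using ereal_dense3 by blast
      then have "\<forall>\<^sub>F n in sequentially. ?R p n \<le> ereal (of_rat q)" using elim(1) by blast
      then show "\<forall>\<^sub>F n in sequentially. ?R p n < b"
        by (rule eventually_mono) (rule le_less_trans[OF _ q(2)])
    qed
  qed
  then show ?thesis by (simp add: dim split_beta')
qed

end
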